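(* Let $X$ be a Kaplansky-Hilbert module over $L^0$ and let $\mathcal{D}\subset X$ be a $bo$-dense submodule containing a vector $e$ with $\|e\|=\mathbf{1}$. Let $\mathcal{U}\subset\mathcal{L}(\mathcal{D})$ be a standard algebra. Then for each $L^0$-linear automorphism $\alpha$ of $\mathcal{U}$ there exists an invertible $x\in\mathcal{L}(\mathcal{D})$ with $x^{-1}\in\mathcal{L}(\mathcal{D})$ such that $\alpha(a)=xax^{-1}$ for all $a\in\mathcal{U}$. In particular, each $L^0$-linear automorphism of the algebra $\mathcal{L}(\mathcal{D})$ is spatial, i.e. of the form $a\mapsto xax^{-1}$ with $x,x^{-1}\in\mathcal{L}(\mathcal{D})$.
   Context: $(\Omega,\Sigma,\mu)$ is a space with a complete finite measure; $L^0=L^0(\Omega)$ is the algebra of all complex measurable functions on it modulo a.e. equality, with unit $\mathbf{1}$. A Kaplansky-Hilbert module over $L^0$ is an $L^0$-module $X$ with an $L^0$-valued inner product $\langle\cdot,\cdot\rangle$ ($\langle\varphi,\varphi\rangle\ge 0$; $\langle\varphi,\varphi\rangle=0$ iff $\varphi=0$; $\langle\varphi,\psi\rangle=\overline{\langle\psi,\varphi\rangle}$; $L^0$-linear in the first variable) such that, with the $L^0$-valued norm $\|\varphi\|=\sqrt{\langle\varphi,\varphi\rangle}$, $X$ is a Banach-Kantorovich space: it is $d$-decomposable (whenever $\|\varphi\|=e_1+e_2$ with $e_1,e_2\ge0$ disjoint in $L^0$, there are $\varphi_1,\varphi_2$ with $\varphi=\varphi_1+\varphi_2$, $\|\varphi_k\|=e_k$)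 and $(bo)$-complete. Here a net $\varphi_\alpha$ $(bo)$-converges to $\varphi$ if $\|\varphi_\alpha-\varphi\|$ $(o)$-converges (order convergence) to $0$ in $L^0$. A subset is $bo$-dense if every element of $X$ is a $bo$-limit of a net from the subset. $\mathcal{L}(\mathcal{D})$ is the algebra of all $L^0$-linear operators $a:\mathcal{D}\to\mathcal{D}$. $\mathcal{F}(\mathcal{D})$ is the algebra of all finite-generated operators in $\mathcal{L}(\mathcal{D})$, i.e. those $a$ whose image $a(\mathcal{D})$ is a finitely generated $L^0$-module. An algebra $\mathcal{U}\subset\mathcal{L}(\mathcal{D})$ over $L^0$ is standard if $\mathcal{F}(\mathcal{D})\subset\mathcal{U}$. An automorphism of an algebra is a bijective linear map $\alpha$ of it onto itself with $\alpha(ab)=\alpha(a)\alpha(b)$ for all $a,b$. *)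

theory Defs
  imports "HOL-Analysis.Analysis" "HOL-Library.Complex_Order" "HOL-Algebra.Module" "HOL-Algebra.Lattice"
begin

section \<open>The algebra of complex measurable functions modulo a.e. equality\<close>

type_synonym 'w L0 = "('w \<Rightarrow> complex) set"

definition L0_class :: "'w measure \<Rightarrow> ('w \<Rightarrow> complex) \<Rightarrow> 'w L0" where
  "L0_class M f = {g \<in> borel_measurable M. AE w in M. g w = f w}"

definition L0_rep :: "'w L0 \<Rightarrow> 'w \<Rightarrow> complex" where
  "L0_rep F = (SOME f. f \<in> F)"

definition L0_map :: "'w measure \<Rightarrow> (complex \<Rightarrow> complex) \<Rightarrow> 'w L0 \<Rightarrow> 'w L0" where
  "L0_map M h F = L0_class M (\<lambda>w. h (L0_rep F w))"

definition L0 :: "'w measure \<Rightarrow> 'w L0 ring" where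
  "L0 M = \<lparr>carrier = L0_class M ` borel_measurable M,
           mult = (\<lambda>F G. L0_class M (\<lambda>w. L0_rep F w * L0_rep G w)),
           one = L0_class M (\<lambda>_. 1),
           zero = L0_class M (\<lambda>_. 0),
           add = (\<lambda>F G. L0_class M (\<lambda>w. L0_rep F w + L0_rep G w))\<rparr>"

text \<open>
  The order of the real part of \<open>L0\<close>, stated on all of \<open>L0\<close>: by the order on \<^typ>\<open>complex\<close>
  from \<open>Complex_Order\<close>, \<open>F \<le> G\<close> means that \<open>G - F\<close> is a.e. real and nonnegative. A set of real
  elements has only real lower bounds, so its infimum is the one taken in the real part.
\<close>

definition L0_order :: "'w measure \<Rightarrow> 'w L0 gorder" where
  "L0_order M = \<lparr>carrier = carrier (L0 M), eq = (=),
                 le = (\<lambda>F G. AE w in M. L0_rep F w \<le> L0_rep G w)\<rparr>"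

abbreviation L0_is_inf :: "'w measure \<Rightarrow> 'w L0 \<Rightarrow> 'w L0 set \<Rightarrow> bool" where
  "L0_is_inf M g E \<equiv> greatest (L0_order M) g (Lower (L0_order M) E)"

definition L0_disjoint :: "'w measure \<Rightarrow> 'w L0 \<Rightarrow> 'w L0 \<Rightarrow> bool" where
  "L0_disjoint M e1 e2 \<longleftrightarrow> L0_is_inf M \<zero>\<^bsub>L0 M\<^esub> {e1, e2}"

text \<open>
  Convergence of nets is expressed by filters. A net indexed by a directed set is a function
  together with the filter of tails of the index set, \<open>net_filter\<close> below; conversely
  every proper filter is the image of such a filter of tails (\<open>proper_filter_is_net\<close>).
\<close>

definition directed_by :: "'i set \<Rightarrow> ('i \<Rightarrow> 'i \<Rightarrow> bool) \<Rightarrow> bool" where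
  "directed_by I leq \<longleftrightarrow> I \<noteq> {} \<and> (\<forall>i\<in>I. leq i i) \<and>
     (\<forall>i\<in>I. \<forall>j\<in>I. \<forall>k\<in>I. leq i j \<longrightarrow> leq j k \<longrightarrow> leq i k) \<and>
     (\<forall>i\<in>I. \<forall>j\<in>I. \<exists>k\<in>I. leq i k \<and> leq j k)"

definition net_filter :: "'i set \<Rightarrow> ('i \<Rightarrow> 'i \<Rightarrow> bool) \<Rightarrow> 'i filter" where
  "net_filter I leq = (INF i\<in>I. principal {j \<in> I. leq i j})"

text \<open>
  Order convergence: \<open>\<bar>f i - l\<bar>\<close> is eventually below each member of a net decreasing to \<open>0\<close>; the
  range of the latter is the downward directed set \<open>E\<close>.
\<close>

definition o_tendsto :: "'w measure \<Rightarrow> ('i \<Rightarrow> 'w L0) \<Rightarrow> 'w L0 \<Rightarrow> 'i filter \<Rightarrow> bool" where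
  "o_tendsto M f l F \<longleftrightarrow>
    (\<exists>E \<subseteq> carrier (L0 M). directed_by E (\<lambda>d e. e \<sqsubseteq>\<^bsub>L0_order M\<^esub> d) \<and> L0_is_inf M \<zero>\<^bsub>L0 M\<^esub> E \<and>
      (\<forall>e\<in>E. \<forall>\<^sub>F i in F.
         L0_map M (\<lambda>z. complex_of_real (cmod z)) (f i \<ominus>\<^bsub>L0 M\<^esub> l) \<sqsubseteq>\<^bsub>L0_order M\<^esub> e))"

section \<open>Kaplansky--Hilbert modules\<close>

definition L0_norm :: "'w measure \<Rightarrow> ('x \<Rightarrow> 'x \<Rightarrow> 'w L0) \<Rightarrow> 'x \<Rightarrow> 'w L0" where
  "L0_norm M ip x = L0_map M csqrt (ip x x)"

definition bo_tendsto :: "'w measure \<Rightarrow> ('w L0, 'x, 'm) module_scheme \<Rightarrow> ('x \<Rightarrow> 'x \<Rightarrow> 'w L0) \<Rightarrow>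
    ('i \<Rightarrow> 'x) \<Rightarrow> 'x \<Rightarrow> 'i filter \<Rightarrow> bool" where
  "bo_tendsto M X ip f x F \<longleftrightarrow> o_tendsto M (\<lambda>i. L0_norm M ip (f i \<ominus>\<^bsub>X\<^esub> x)) \<zero>\<^bsub>L0 M\<^esub> F"

definition bo_fundamental :: "'w measure \<Rightarrow> ('w L0, 'x, 'm) module_scheme \<Rightarrow>
    ('x \<Rightarrow> 'x \<Rightarrow> 'w L0) \<Rightarrow> ('i \<Rightarrow> 'x) \<Rightarrow> 'i filter \<Rightarrow> bool" where
  "bo_fundamental M X ip f F \<longleftrightarrow>
    o_tendsto M (\<lambda>(i, j). L0_norm M ip (f i \<ominus>\<^bsub>X\<^esub> f j)) \<zero>\<^bsub>L0 M\<^esub> (F \<times>\<^sub>F F)"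

definition bo_complete :: "'w measure \<Rightarrow> ('w L0, 'x, 'm) module_scheme \<Rightarrow>
    ('x \<Rightarrow> 'x \<Rightarrow> 'w L0) \<Rightarrow> bool" where
  "bo_complete M X ip \<longleftrightarrow>
    (\<forall>F. F \<noteq> bot \<longrightarrow> F \<le> principal (carrier X) \<longrightarrow> bo_fundamental M X ip (\<lambda>x. x) F \<longrightarrow>
      (\<exists>x\<in>carrier X. bo_tendsto M X ip (\<lambda>x. x) x F))"

definition bo_dense :: "'w measure \<Rightarrow> ('w L0, 'x, 'm) module_scheme \<Rightarrow>
    ('x \<Rightarrow> 'x \<Rightarrow> 'w L0) \<Rightarrow> 'x set \<Rightarrow> bool" where
  "bo_dense M X ip D \<longleftrightarrow>
    (\<forall>x\<in>carrier X. \<exists>F. F \<noteq> bot \<and> F \<le> principal D \<and> bo_tendsto M X ip (\<lambda>x. x) x F)"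

definition d_decomposable :: "'w measure \<Rightarrow> ('w L0, 'x, 'm) module_scheme \<Rightarrow>
    ('x \<Rightarrow> 'x \<Rightarrow> 'w L0) \<Rightarrow> bool" where
  "d_decomposable M X ip \<longleftrightarrow>
    (\<forall>x\<in>carrier X. \<forall>e1\<in>carrier (L0 M). \<forall>e2\<in>carrier (L0 M).
      \<zero>\<^bsub>L0 M\<^esub> \<sqsubseteq>\<^bsub>L0_order M\<^esub> e1 \<longrightarrow> \<zero>\<^bsub>L0 M\<^esub> \<sqsubseteq>\<^bsub>L0_order M\<^esub> e2 \<longrightarrow> L0_disjoint M e1 e2 \<longrightarrow>
      L0_norm M ip x = e1 \<oplus>\<^bsub>L0 M\<^esub> e2 \<longrightarrow>
      (\<exists>x1\<in>carrier X. \<exists>x2\<in>carrier X.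
        x = x1 \<oplus>\<^bsub>X\<^esub> x2 \<and> L0_norm M ip x1 = e1 \<and> L0_norm M ip x2 = e2))"

locale kaplansky_hilbert_module =
  X: module "L0 M" X for M :: "'w measure" and X :: "('w L0, 'x, 'm) module_scheme" +
  fixes ip :: "'x \<Rightarrow> 'x \<Rightarrow> 'w L0"
  assumes ip_closed: "\<lbrakk>x \<in> carrier X; y \<in> carrier X\<rbrakk> \<Longrightarrow> ip x y \<in> carrier (L0 M)"
    and ip_nonneg: "x \<in> carrier X \<Longrightarrow> \<zero>\<^bsub>L0 M\<^esub> \<sqsubseteq>\<^bsub>L0_order M\<^esub> ip x x"
    and ip_eq_zero: "x \<in> carrier X \<Longrightarrow> ip x x = \<zero>\<^bsub>L0 M\<^esub> \<longleftrightarrow> x = \<zero>\<^bsub>X\<^esub>"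
    and ip_cnj: "\<lbrakk>x \<in> carrier X; y \<in> carrier X\<rbrakk> \<Longrightarrow> ip x y = L0_map M cnj (ip y x)"
    and ip_add: "\<lbrakk>x \<in> carrier X; y \<in> carrier X; z \<in> carrier X\<rbrakk> \<Longrightarrow>
          ip (x \<oplus>\<^bsub>X\<^esub> y) z = ip x z \<oplus>\<^bsub>L0 M\<^esub> ip y z"
    and ip_smult: "\<lbrakk>a \<in> carrier (L0 M); x \<in> carrier X; y \<in> carrier X\<rbrakk> \<Longrightarrow>
          ip (a \<odot>\<^bsub>X\<^esub> x) y = a \<otimes>\<^bsub>L0 M\<^esub> ip x y"
    and decomposable: "d_decomposable M X ip"
    and complete: "bo_complete M X ip"

section \<open>Algebras of linear operators\<close>

text \<open>Operators are extensional functions, so that equality of operators is equality on the module.\<close>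

definition lin_ops :: "('a, 'r) ring_scheme \<Rightarrow> ('a, 'x, 'm) module_scheme \<Rightarrow> ('a, 'x \<Rightarrow> 'x) module" where
  "lin_ops R N =
    \<lparr>carrier = {f \<in> carrier N \<rightarrow>\<^sub>E carrier N.
        (\<forall>x\<in>carrier N. \<forall>y\<in>carrier N. f (x \<oplus>\<^bsub>N\<^esub> y) = f x \<oplus>\<^bsub>N\<^esub> f y) \<and>
        (\<forall>a\<in>carrier R. \<forall>x\<in>carrier N. f (a \<odot>\<^bsub>N\<^esub> x) = a \<odot>\<^bsub>N\<^esub> f x)},
     mult = compose (carrier N),
     one = (\<lambda>x\<in>carrier N. x),
     zero = (\<lambda>x\<in>carrier N. \<zero>\<^bsub>N\<^esub>),
     add = (\<lambda>f g. \<lambda>x\<in>carrier N. f x \<oplus>\<^bsub>N\<^esub> g x),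
     smult = (\<lambda>a f. \<lambda>x\<in>carrier N. a \<odot>\<^bsub>N\<^esub> f x)\<rparr>"

definition generated_by :: "('a, 'r) ring_scheme \<Rightarrow> ('a, 'x, 'm) module_scheme \<Rightarrow> 'x set \<Rightarrow> 'x set" where
  "generated_by R N S = \<Inter>{K. submodule K R N \<and> S \<subseteq> K}"

definition fin_gen_ops :: "('a, 'r) ring_scheme \<Rightarrow> ('a, 'x, 'm) module_scheme \<Rightarrow> ('x \<Rightarrow> 'x) set" where
  "fin_gen_ops R N =
    {f \<in> carrier (lin_ops R N).
      \<exists>S. finite S \<and> S \<subseteq> carrier N \<and> f ` carrier N = generated_by R N S}"

text \<open>Subalgebras need not contain the identity.\<close>

definition subalgebra_of :: "('a, 'r) ring_scheme \<Rightarrow> ('a, 'b, 'm) module_scheme \<Rightarrow> 'b set \<Rightarrow> bool" where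
  "subalgebra_of R A U \<longleftrightarrow> submodule U R A \<and> (\<forall>a\<in>U. \<forall>b\<in>U. a \<otimes>\<^bsub>A\<^esub> b \<in> U)"

definition standard_algebra :: "('a, 'r) ring_scheme \<Rightarrow> ('a, 'x, 'm) module_scheme \<Rightarrow> ('x \<Rightarrow> 'x) set \<Rightarrow> bool" where
  "standard_algebra R N U \<longleftrightarrow> subalgebra_of R (lin_ops R N) U \<and> fin_gen_ops R N \<subseteq> U"

definition algebra_automorphism ::
    "('a, 'r) ring_scheme \<Rightarrow> ('a, 'b, 'm) module_scheme \<Rightarrow> 'b set \<Rightarrow> ('b \<Rightarrow> 'b) \<Rightarrow> bool" where
  "algebra_automorphism R A U \<alpha> \<longleftrightarrow> bij_betw \<alpha> U U \<and>
    (\<forall>a\<in>U. \<forall>b\<in>U. \<alpha> (a \<oplus>\<^bsub>A\<^esub> b) = \<alpha> a \<oplus>\<^bsub>A\<^esub> \<alpha> b) \<and>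
    (\<forall>c\<in>carrier R. \<forall>a\<in>U. \<alpha> (c \<odot>\<^bsub>A\<^esub> a) = c \<odot>\<^bsub>A\<^esub> \<alpha> a) \<and>
    (\<forall>a\<in>U. \<forall>b\<in>U. \<alpha> (a \<otimes>\<^bsub>A\<^esub> b) = \<alpha> a \<otimes>\<^bsub>A\<^esub> \<alpha> b)"

definition spatial_on :: "('a, 'b, 'm) module_scheme \<Rightarrow> 'b set \<Rightarrow> ('b \<Rightarrow> 'b) \<Rightarrow> bool" where
  "spatial_on A U \<alpha> \<longleftrightarrow> (\<exists>x\<in>Units A. \<forall>a\<in>U. \<alpha> a = x \<otimes>\<^bsub>A\<^esub> a \<otimes>\<^bsub>A\<^esub> inv\<^bsub>A\<^esub> x)"

abbreviation \<L> :: "'w measure \<Rightarrow> ('w L0, 'x, 'm) module_scheme \<Rightarrow> 'x set \<Rightarrow>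
    ('w L0, 'x \<Rightarrow> 'x) module" where
  "\<L> M X D \<equiv> lin_ops (L0 M) (X\<lparr>carrier := D\<rparr>)"

section \<open>Basic facts\<close>

lemma net_filter_eventually:
  assumes "directed_by I leq"
  shows "eventually P (net_filter I leq) \<longleftrightarrow> (\<exists>i\<in>I. \<forall>j\<in>I. leq i j \<longrightarrow> P j)"
proof -
  have "eventually P (net_filter I leq) \<longleftrightarrow> (\<exists>i\<in>I. eventually P (principal {j \<in> I. leq i j}))"
    unfolding net_filter_def
  proof (rule eventually_INF_base)
    show "I \<noteq> {}" using assms by (simp add: directed_by_def)
    fix i j assume ij: "i \<in> I" "j \<in> I"
    then obtain k where k: "k \<in> I" "leq i k" "leq j k"
      using assms unfolding directed_by_def by blast
    have "{l \<in> I. leq k l} \<subseteq> {l \<in> I. leq i l} \<inter> {l \<in> I. leq j l}"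
      using assms ij k unfolding directed_by_def by blast
    with k show "\<exists>x\<in>I. principal {l \<in> I. leq x l} \<le>
        inf (principal {l \<in> I. leq i l}) (principal {l \<in> I. leq j l})"
      by (auto intro!: bexI[of _ k])
  qed
  then show ?thesis by (auto simp: eventually_principal)
qed

lemma net_filter_neq_bot:
  assumes "directed_by I leq"
  shows "net_filter I leq \<noteq> bot"
proof -
  have "\<not> eventually (\<lambda>_. False) (net_filter I leq)"
    unfolding net_filter_eventually[OF assms] using assms unfolding directed_by_def by blast
  then show ?thesis by (simp add: trivial_limit_def)
qed

lemma proper_filter_is_net:
  fixes F :: "'x filter"
  assumes "F \<noteq> bot" "F \<le> principal A"
  shows "\<exists>(I :: ('x set \<times> 'x) set) leq. directed_by I leq \<and> snd ` I \<subseteq> A \<and>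
           F = filtermap snd (net_filter I leq)"
proof -
  define I where "I = {(B, b). eventually (\<lambda>x. x \<in> B) F \<and> B \<subseteq> A \<and> b \<in> B}"
  define leq :: "'x set \<times> 'x \<Rightarrow> 'x set \<times> 'x \<Rightarrow> bool" where "leq p q \<longleftrightarrow> fst q \<subseteq> fst p" for p q
  have A: "eventually (\<lambda>x. x \<in> A) F"
    using assms(2) by (simp add: le_principal)
  have ne: "\<exists>b. (B, b) \<in> I" if "eventually (\<lambda>x. x \<in> B) F" "B \<subseteq> A" for B
    using that eventually_happens'[OF assms(1) that(1)] by (auto simp: I_def)
  have dir: "directed_by I leq"
    unfolding directed_by_def
  proof (intro conjI ballI impI)
    show "I \<noteq> {}" using ne[OF A] by blast
    fix p q assume pq: "p \<in> I" "q \<in> I"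
    then have "eventually (\<lambda>x. x \<in> fst p \<inter> fst q) F" "fst p \<inter> fst q \<subseteq> A"
      by (auto simp: I_def intro: eventually_conj)
    from ne[OF this] obtain b where "(fst p \<inter> fst q, b) \<in> I" by blast
    then show "\<exists>k\<in>I. leq p k \<and> leq q k"
      by (intro bexI[of _ "(fst p \<inter> fst q, b)"]) (auto simp: leq_def)
  qed (auto simp: leq_def)
  have "eventually P F \<longleftrightarrow> eventually P (filtermap snd (net_filter I leq))" for P
  proof
    assume P: "eventually P F"
    then have "eventually (\<lambda>x. x \<in> {x \<in> A. P x}) F" using A by (simp add: eventually_conj)
    from ne[OF this] obtain b where "({x \<in> A. P x}, b) \<in> I" by auto
    then show "eventually P (filtermap snd (net_filter I leq))"
      unfolding eventually_filtermap net_filter_eventually[OF dir]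
      by (intro bexI[of _ "({x \<in> A. P x}, b)"]) (auto simp: leq_def I_def)
  next
    assume "eventually P (filtermap snd (net_filter I leq))"
    then obtain p where p: "p \<in> I" "\<forall>q\<in>I. fst q \<subseteq> fst p \<longrightarrow> P (snd q)"
      unfolding eventually_filtermap net_filter_eventually[OF dir] leq_def by blast
    have "P x" if "x \<in> fst p" for x
      using p(2)[rule_format, of "(fst p, x)"] p(1) that by (auto simp: I_def)
    then show "eventually P F"
      using p(1) by (auto simp: I_def elim: eventually_mono)
  qed
  then have "F = filtermap snd (net_filter I leq)" by (simp add: filter_eq_iff)
  moreover have "snd ` I \<subseteq> A" by (auto simp: I_def)
  ultimately show ?thesis using dir by blast
qed

lemma bo_tendsto_filtermap:
  "bo_tendsto M X ip g x (filtermap f F) \<longleftrightarrow> bo_tendsto M X ip (\<lambda>i. g (f i)) x F"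
  by (simp add: bo_tendsto_def o_tendsto_def eventually_filtermap)

lemma bo_fundamental_filtermap:
  "bo_fundamental M X ip g (filtermap f F) \<longleftrightarrow> bo_fundamental M X ip (\<lambda>i. g (f i)) F"
proof -
  have "filtermap f F \<times>\<^sub>F filtermap f F = filtermap (\<lambda>(i, j). (f i, f j)) (F \<times>\<^sub>F F)"
    by (simp add: prod_filtermap1 prod_filtermap2 filtermap_filtermap case_prod_unfold map_prod_def apfst_def apsnd_def)
  then show ?thesis
    by (simp add: bo_fundamental_def o_tendsto_def eventually_filtermap case_prod_unfold)
qed

lemma L0_rep_class:
  assumes "f \<in> borel_measurable M"
  shows "L0_rep (L0_class M f) \<in> borel_measurable M" "AE w in M. L0_rep (L0_class M f) w = f w"
proof -
  have "f \<in> L0_class M f" using assms by (simp add: L0_class_def)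
  then have "L0_rep (L0_class M f) \<in> L0_class M f" unfolding L0_rep_def by (rule someI[where P = "\<lambda>h. h \<in> L0_class M f"])
  then show "L0_rep (L0_class M f) \<in> borel_measurable M" "AE w in M. L0_rep (L0_class M f) w = f w"
    by (auto simp: L0_class_def)
qed

lemma L0_class_eqI:
  assumes "AE w in M. f w = g w"
  shows "L0_class M f = L0_class M g"
proof -
  have "(AE w in M. h w = f w) \<longleftrightarrow> (AE w in M. h w = g w)" for h
    using assms by (intro eventually_subst) (auto elim: eventually_mono)
  then show ?thesis by (simp add: L0_class_def)
qed

lemma L0_class_mult:
  assumes "f \<in> borel_measurable M" "g \<in> borel_measurable M"
  shows "L0_class M f \<otimes>\<^bsub>L0 M\<^esub> L0_class M g = L0_class M (\<lambda>w. f w * g w)"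
proof -
  have "AE w in M. L0_rep (L0_class M f) w * L0_rep (L0_class M g) w = f w * g w"
    using L0_rep_class(2)[OF assms(1)] L0_rep_class(2)[OF assms(2)] by eventually_elim simp
  then show ?thesis by (simp add: L0_def L0_class_eqI)
qed

lemma L0_class_add:
  assumes "f \<in> borel_measurable M" "g \<in> borel_measurable M"
  shows "L0_class M f \<oplus>\<^bsub>L0 M\<^esub> L0_class M g = L0_class M (\<lambda>w. f w + g w)"
proof -
  have "AE w in M. L0_rep (L0_class M f) w + L0_rep (L0_class M g) w = f w + g w"
    using L0_rep_class(2)[OF assms(1)] L0_rep_class(2)[OF assms(2)] by eventually_elim simp
  then show ?thesis by (simp add: L0_def L0_class_eqI)
qed

lemma L0_cring: "cring (L0 M)"
proof -
  have c: "carrier (L0 M) = L0_class M ` borel_measurable M"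
    and o: "\<one>\<^bsub>L0 M\<^esub> = L0_class M (\<lambda>_. 1)" and z: "\<zero>\<^bsub>L0 M\<^esub> = L0_class M (\<lambda>_. 0)"
    by (simp_all add: L0_def)
  have zo: "(\<lambda>_. 0) \<in> borel_measurable M" "(\<lambda>_. 1) \<in> borel_measurable M" by simp_all
  note L = c o z L0_class_mult L0_class_add zo
  show ?thesis
  proof (intro cringI abelian_groupI comm_monoidI)
    fix x assume "x \<in> carrier (L0 M)"
    then obtain f where f: "f \<in> borel_measurable M" "x = L0_class M f" by (auto simp: c)
    then show "\<exists>y\<in>carrier (L0 M). y \<oplus>\<^bsub>L0 M\<^esub> x = \<zero>\<^bsub>L0 M\<^esub>"
      by (intro bexI[of _ "L0_class M (\<lambda>w. - f w)"]) (simp_all add: L)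
  qed (auto simp only: L imageI borel_measurable_add borel_measurable_times
        ac_simps distrib_right distrib_left add_0_left add_0_right mult_1_left mult_1_right)
qed

end

theory Submission
  imports Defs
begin

text \<open>
  Write \<open>y \<otimes> f\<close> for the operator \<open>u \<mapsto> f u \<odot> y\<close>, where \<open>y\<close> is a vector and \<open>f\<close> a linear
  functional on \<open>D\<close>. The vector \<open>e\<close> of norm one provides the functional \<open>\<phi> = \<langle>\<cdot>, e\<rangle>\<close> with
  \<open>\<phi> e = 1\<close>, and with it the idempotent \<open>p = e \<otimes> \<phi>\<close>. The range of \<open>y \<otimes> f\<close> need not be finitely
  generated, since the values of \<open>f\<close> may form an ideal that is not; it is \<open>L0 \<odot> y\<close>, however, as soon as
  \<open>f e = 1\<close>, and every \<open>f\<close> differs from such a functional by a multiple of \<open>\<phi>\<close>. So a standard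
  algebra contains all operators \<open>y \<otimes> f\<close>.

  Let \<open>\<alpha>\<close> be an automorphism and \<open>q = \<alpha> p\<close>. As for operators on a vector space, one wants a
  vector \<open>z\<close> in the range of \<open>q\<close> and defines \<open>x y = \<alpha> (y \<otimes> \<phi>) z\<close>; then
  \<open>x (a y) = \<alpha> a (x y)\<close> because \<open>a y \<otimes> \<phi> = a (y \<otimes> \<phi>)\<close>. Over a ring, \<open>x\<close> is bijective if \<open>z\<close> is
  unimodular, that is, \<open>f z = 1\<close> for some functional \<open>f\<close>
  (\<open>spatial_if_q_range_has_unimodular\<close>); this part holds over every commutative ring. With
  \<open>f = \<langle>\<cdot>, z\<rangle> / \<langle>z, z\<rangle>\<close> it suffices that \<open>\<langle>z, z\<rangle>\<close> vanishes almost nowhere.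

  The difficulty is that such a \<open>z\<close> must be glued from countably many vectors with disjoint
  supports, and \<open>D\<close> need not be closed under this operation. But the dual of \<open>D\<close> is: functionals take
  their values in \<open>L0\<close>, where gluing is possible. And \<open>\<alpha>\<close> turns functionals into vectors: every
  vector \<open>w\<close> in the range of \<open>q\<close> has the form \<open>\<alpha> (e \<otimes> h) e\<close> for a functional \<open>h\<close>
  (\<open>coordinate_functional\<close>), so gluing the functionals glues the vectors (\<open>q_range_mixing\<close>).
  As the measure is finite, an exhaustion now gives a vector in the range of \<open>q\<close> with the largest
  support (\<open>q_range_full_support\<close>); off this support \<open>q\<close> vanishes, hence so does \<open>p\<close>, and
  therefore the support is the whole space.
\<close>

section \<open>Linear functionals and operators of rank one\<close>

context module
begin

definition dual :: "('c \<Rightarrow> 'a) set" where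
  "dual = {f \<in> carrier M \<rightarrow> carrier R.
     (\<forall>x\<in>carrier M. \<forall>y\<in>carrier M. f (x \<oplus>\<^bsub>M\<^esub> y) = f x \<oplus> f y) \<and>
     (\<forall>a\<in>carrier R. \<forall>x\<in>carrier M. f (a \<odot>\<^bsub>M\<^esub> x) = a \<otimes> f x)}"

definition rank_one :: "'c \<Rightarrow> ('c \<Rightarrow> 'a) \<Rightarrow> 'c \<Rightarrow> 'c" where
  "rank_one x f = (\<lambda>u\<in>carrier M. f u \<odot>\<^bsub>M\<^esub> x)"

lemma dual_closed [simp]: "\<lbrakk>f \<in> dual; x \<in> carrier M\<rbrakk> \<Longrightarrow> f x \<in> carrier R"
  and dual_add: "\<lbrakk>f \<in> dual; x \<in> carrier M; y \<in> carrier M\<rbrakk> \<Longrightarrow> f (x \<oplus>\<^bsub>M\<^esub> y) = f x \<oplus> f y"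
  and dual_smult: "\<lbrakk>f \<in> dual; a \<in> carrier R; x \<in> carrier M\<rbrakk> \<Longrightarrow> f (a \<odot>\<^bsub>M\<^esub> x) = a \<otimes> f x"
  by (auto simp: dual_def)

lemma dualI:
  assumes "\<And>x. x \<in> carrier M \<Longrightarrow> f x \<in> carrier R"
    "\<And>x y. \<lbrakk>x \<in> carrier M; y \<in> carrier M\<rbrakk> \<Longrightarrow> f (x \<oplus>\<^bsub>M\<^esub> y) = f x \<oplus> f y"
    "\<And>a x. \<lbrakk>a \<in> carrier R; x \<in> carrier M\<rbrakk> \<Longrightarrow> f (a \<odot>\<^bsub>M\<^esub> x) = a \<otimes> f x"
  shows "f \<in> dual"
  unfolding dual_def using assms by blast

lemma dual_sum: "\<lbrakk>f \<in> dual; g \<in> dual\<rbrakk> \<Longrightarrow> (\<lambda>u. f u \<oplus> g u) \<in> dual"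
  by (rule dualI) (simp_all add: dual_add dual_smult R.r_distr R.a_ac)

lemma dual_scaled: "\<lbrakk>c \<in> carrier R; f \<in> dual\<rbrakk> \<Longrightarrow> (\<lambda>u. c \<otimes> f u) \<in> dual"
  by (rule dualI) (simp_all add: dual_add dual_smult R.r_distr R.m_lcomm)

lemma lin_ops_simps [simp]:
  "\<one>\<^bsub>lin_ops R M\<^esub> = (\<lambda>x\<in>carrier M. x)"
  "\<zero>\<^bsub>lin_ops R M\<^esub> = (\<lambda>x\<in>carrier M. \<zero>\<^bsub>M\<^esub>)"
  "a \<otimes>\<^bsub>lin_ops R M\<^esub> b = compose (carrier M) a b"
  "a \<oplus>\<^bsub>lin_ops R M\<^esub> b = (\<lambda>x\<in>carrier M. a x \<oplus>\<^bsub>M\<^esub> b x)"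
  "c \<odot>\<^bsub>lin_ops R M\<^esub> a = (\<lambda>x\<in>carrier M. c \<odot>\<^bsub>M\<^esub> a x)"
  by (simp_all add: lin_ops_def)

lemma lin_op_closed [simp]: "\<lbrakk>a \<in> carrier (lin_ops R M); x \<in> carrier M\<rbrakk> \<Longrightarrow> a x \<in> carrier M"
  and lin_op_add: "\<lbrakk>a \<in> carrier (lin_ops R M); x \<in> carrier M; y \<in> carrier M\<rbrakk> \<Longrightarrow>
    a (x \<oplus>\<^bsub>M\<^esub> y) = a x \<oplus>\<^bsub>M\<^esub> a y"
  and lin_op_smult: "\<lbrakk>a \<in> carrier (lin_ops R M); c \<in> carrier R; x \<in> carrier M\<rbrakk> \<Longrightarrow>
    a (c \<odot>\<^bsub>M\<^esub> x) = c \<odot>\<^bsub>M\<^esub> a x"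
  and lin_op_extensional: "a \<in> carrier (lin_ops R M) \<Longrightarrow> a \<in> extensional (carrier M)"
  by (auto simp: lin_ops_def PiE_iff)

lemma lin_opI:
  assumes "a \<in> extensional (carrier M)" "\<And>x. x \<in> carrier M \<Longrightarrow> a x \<in> carrier M"
    "\<And>x y. \<lbrakk>x \<in> carrier M; y \<in> carrier M\<rbrakk> \<Longrightarrow> a (x \<oplus>\<^bsub>M\<^esub> y) = a x \<oplus>\<^bsub>M\<^esub> a y"
    "\<And>c x. \<lbrakk>c \<in> carrier R; x \<in> carrier M\<rbrakk> \<Longrightarrow> a (c \<odot>\<^bsub>M\<^esub> x) = c \<odot>\<^bsub>M\<^esub> a x"
  shows "a \<in> carrier (lin_ops R M)"
  unfolding lin_ops_def partial_object.simps PiE_iff using assms by blast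

lemma lin_op_eqI:
  assumes "a \<in> carrier (lin_ops R M)" "b \<in> carrier (lin_ops R M)"
    "\<And>x. x \<in> carrier M \<Longrightarrow> a x = b x"
  shows "a = b"
  using assms by (auto intro: extensionalityI lin_op_extensional)

lemma lin_ops_monoid: "monoid (lin_ops R M)"
proof (rule monoidI)
  fix a b assume ab: "a \<in> carrier (lin_ops R M)" "b \<in> carrier (lin_ops R M)"
  then show "a \<otimes>\<^bsub>lin_ops R M\<^esub> b \<in> carrier (lin_ops R M)"
    by (intro lin_opI) (simp_all add: compose_def lin_op_add lin_op_smult)
  fix c assume c: "c \<in> carrier (lin_ops R M)"
  show "a \<otimes>\<^bsub>lin_ops R M\<^esub> b \<otimes>\<^bsub>lin_ops R M\<^esub> c = a \<otimes>\<^bsub>lin_ops R M\<^esub> (b \<otimes>\<^bsub>lin_ops R M\<^esub> c)"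
    using ab c by (auto simp: compose_def fun_eq_iff)
next
  show "\<one>\<^bsub>lin_ops R M\<^esub> \<in> carrier (lin_ops R M)" by (rule lin_opI) auto
  fix a assume a: "a \<in> carrier (lin_ops R M)"
  show "\<one>\<^bsub>lin_ops R M\<^esub> \<otimes>\<^bsub>lin_ops R M\<^esub> a = a" "a \<otimes>\<^bsub>lin_ops R M\<^esub> \<one>\<^bsub>lin_ops R M\<^esub> = a"
    using a lin_op_extensional[OF a]
    by (auto intro: extensionalityI[of _ "carrier M"] simp: compose_eq)
qed

lemma lin_ops_module: "module R (lin_ops R M)"
proof (intro moduleI abelian_groupI)
  show "cring R" by (rule R.is_cring)
  show "\<zero>\<^bsub>lin_ops R M\<^esub> \<in> carrier (lin_ops R M)" by (rule lin_opI) auto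
next
  fix a assume a: "a \<in> carrier (lin_ops R M)"
  show "\<zero>\<^bsub>lin_ops R M\<^esub> \<oplus>\<^bsub>lin_ops R M\<^esub> a = a" "\<one> \<odot>\<^bsub>lin_ops R M\<^esub> a = a"
    using a lin_op_extensional[OF a] by (auto intro: extensionalityI[of _ "carrier M"])
  have "(\<lambda>x\<in>carrier M. \<ominus>\<^bsub>M\<^esub> a x) \<in> carrier (lin_ops R M)"
    using a by (intro lin_opI) (simp_all add: lin_op_add lin_op_smult M.minus_add smult_r_minus)
  then show "\<exists>b\<in>carrier (lin_ops R M). b \<oplus>\<^bsub>lin_ops R M\<^esub> a = \<zero>\<^bsub>lin_ops R M\<^esub>"
    using a by (intro bexI) (auto simp: fun_eq_iff M.l_neg)
next
  fix a b assume "a \<in> carrier (lin_ops R M)" "b \<in> carrier (lin_ops R M)"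
  then show "a \<oplus>\<^bsub>lin_ops R M\<^esub> b \<in> carrier (lin_ops R M)"
    by (intro lin_opI) (simp_all add: lin_op_add lin_op_smult M.a_ac smult_r_distr)
next
  fix c a assume "c \<in> carrier R" "a \<in> carrier (lin_ops R M)"
  then show "c \<odot>\<^bsub>lin_ops R M\<^esub> a \<in> carrier (lin_ops R M)"
    by (intro lin_opI)
      (simp_all add: lin_op_add lin_op_smult smult_r_distr R.m_comm flip: smult_assoc1)
qed (auto simp: fun_eq_iff M.a_ac smult_l_distr smult_r_distr smult_assoc1)

lemma carrier_standard: "standard_algebra R M (carrier (lin_ops R M))"
  using module.carrier_is_submodule[OF lin_ops_module] monoid.m_closed[OF lin_ops_monoid]
  by (auto simp: standard_algebra_def subalgebra_of_def fin_gen_ops_def)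

lemma bij_lin_op_Units:
  assumes x: "x \<in> carrier (lin_ops R M)" and bij: "bij_betw x (carrier M) (carrier M)"
  shows "x \<in> Units (lin_ops R M)"
proof -
  define y where "y = (\<lambda>u\<in>carrier M. inv_into (carrier M) x u)"
  have yc: "y u \<in> carrier M" and xy: "x (y u) = u" if "u \<in> carrier M" for u
    using bij that by (auto simp: y_def bij_betw_def inv_into_into f_inv_into_f)
  have yx: "y (x u) = u" if "u \<in> carrier M" for u
    using bij that x by (auto simp: y_def bij_betw_def)
  have "y \<in> carrier (lin_ops R M)"
  proof (rule lin_opI)
    fix u v assume uv: "u \<in> carrier M" "v \<in> carrier M"
    then have "y (x (y u \<oplus>\<^bsub>M\<^esub> y v)) = y u \<oplus>\<^bsub>M\<^esub> y v" by (intro yx) (simp add: yc)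
    then show "y (u \<oplus>\<^bsub>M\<^esub> v) = y u \<oplus>\<^bsub>M\<^esub> y v" using uv x by (simp add: lin_op_add yc xy)
  next
    fix c v assume cv: "c \<in> carrier R" "v \<in> carrier M"
    then have "y (x (c \<odot>\<^bsub>M\<^esub> y v)) = c \<odot>\<^bsub>M\<^esub> y v" by (intro yx) (simp add: yc)
    then show "y (c \<odot>\<^bsub>M\<^esub> v) = c \<odot>\<^bsub>M\<^esub> y v" using cv x by (simp add: lin_op_smult yc xy)
  qed (simp_all add: yc, simp add: y_def)
  moreover have "x \<otimes>\<^bsub>lin_ops R M\<^esub> y = \<one>\<^bsub>lin_ops R M\<^esub>" "y \<otimes>\<^bsub>lin_ops R M\<^esub> x = \<one>\<^bsub>lin_ops R M\<^esub>"
    using xy yx by (auto simp: compose_def fun_eq_iff)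
  ultimately show ?thesis using x by (auto simp: Units_def)
qed

lemma rank_one_apply [simp]: "u \<in> carrier M \<Longrightarrow> rank_one x f u = f u \<odot>\<^bsub>M\<^esub> x"
  by (simp add: rank_one_def)

lemma rank_one_lin_op: "\<lbrakk>x \<in> carrier M; f \<in> dual\<rbrakk> \<Longrightarrow> rank_one x f \<in> carrier (lin_ops R M)"
  by (rule lin_opI) (auto simp: rank_one_def dual_add dual_smult smult_l_distr smult_assoc1)

text \<open>
  The condition \<open>f e = \<one>\<close> makes \<open>f\<close> surjective, so that the range is the whole cyclic module
  generated by \<open>x\<close>.
\<close>

lemma rank_one_finitely_generated:
  assumes "e \<in> carrier M" "f \<in> dual" "f e = \<one>" "x \<in> carrier M"
  shows "rank_one x f \<in> fin_gen_ops R M"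
proof -
  have "rank_one x f ` carrier M = generated_by R M {x}"
  proof
    show "rank_one x f ` carrier M \<subseteq> generated_by R M {x}"
      using assms by (auto simp: generated_by_def intro: submodule.smult_closed)
    have "submodule (rank_one x f ` carrier M) R M"
    proof (rule submoduleI; (elim imageE)?)
      show "\<zero>\<^bsub>M\<^esub> \<in> rank_one x f ` carrier M"
        using assms dual_smult[of f \<zero> e] by (intro image_eqI[of _ _ "\<zero>\<^bsub>M\<^esub>"]) simp_all
    next
      fix a u assume u: "a = rank_one x f u" "u \<in> carrier M"
      have "f (\<ominus> \<one> \<odot>\<^bsub>M\<^esub> u) \<odot>\<^bsub>M\<^esub> x = \<ominus>\<^bsub>M\<^esub> a"
        using assms u by (subst dual_smult) (auto simp: smult_l_minus R.l_minus)
      then show "\<ominus>\<^bsub>M\<^esub> a \<in> rank_one x f ` carrier M"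
        using u by (intro image_eqI[of _ _ "\<ominus> \<one> \<odot>\<^bsub>M\<^esub> u"]) simp_all
    next
      fix a b u v assume "a = rank_one x f u" "u \<in> carrier M" "b = rank_one x f v" "v \<in> carrier M"
      then show "a \<oplus>\<^bsub>M\<^esub> b \<in> rank_one x f ` carrier M"
        using assms by (intro image_eqI[of _ _ "u \<oplus>\<^bsub>M\<^esub> v"]) (simp_all add: dual_add smult_l_distr)
    next
      fix c a u assume "c \<in> carrier R" "a = rank_one x f u" "u \<in> carrier M"
      then show "c \<odot>\<^bsub>M\<^esub> a \<in> rank_one x f ` carrier M"
        using assms by (intro image_eqI[of _ _ "c \<odot>\<^bsub>M\<^esub> u"]) (simp_all add: dual_smult smult_assoc1)
    qed (use assms in auto)
    moreover have "x \<in> rank_one x f ` carrier M"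
      using assms by (intro image_eqI[of _ _ e]) simp_all
    ultimately show "generated_by R M {x} \<subseteq> rank_one x f ` carrier M"
      by (auto simp: generated_by_def)
  qed
  then show ?thesis
    using assms by (auto simp: fin_gen_ops_def rank_one_lin_op intro!: exI[of _ "{x}"])
qed

end

section \<open>The image of a rank-one projection\<close>

locale standard_automorphism = module R M for R (structure) and M (structure) +
  fixes e :: 'c and \<phi> :: "'c \<Rightarrow> 'a" and U :: "('c \<Rightarrow> 'c) set"
    and \<alpha> :: "('c \<Rightarrow> 'c) \<Rightarrow> 'c \<Rightarrow> 'c"
  assumes e [simp]: "e \<in> carrier M" and \<phi> [simp]: "\<phi> \<in> dual" and \<phi>_e [simp]: "\<phi> e = \<one>"
    and standard: "standard_algebra R M U"
    and automorphism: "algebra_automorphism R (lin_ops R M) U \<alpha>"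
begin

abbreviation p :: "'c \<Rightarrow> 'c" where "p \<equiv> rank_one e \<phi>"
abbreviation q :: "'c \<Rightarrow> 'c" where "q \<equiv> \<alpha> p"

lemma U_lin_op: "a \<in> U \<Longrightarrow> a \<in> carrier (lin_ops R M)"
  using module.submoduleE(1)[OF lin_ops_module] standard
  by (auto simp: standard_algebra_def subalgebra_of_def)

lemma U_smult: "\<lbrakk>c \<in> carrier R; a \<in> U\<rbrakk> \<Longrightarrow> (\<lambda>u\<in>carrier M. c \<odot>\<^bsub>M\<^esub> a u) \<in> U"
  using module.submoduleE(4)[OF lin_ops_module] standard
  by (auto simp: standard_algebra_def subalgebra_of_def)

lemma U_add: "\<lbrakk>a \<in> U; b \<in> U\<rbrakk> \<Longrightarrow> (\<lambda>u\<in>carrier M. a u \<oplus>\<^bsub>M\<^esub> b u) \<in> U"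
  using module.submoduleE(5)[OF lin_ops_module] standard
  by (auto simp: standard_algebra_def subalgebra_of_def)

lemma \<alpha>_closed [simp]: "a \<in> U \<Longrightarrow> \<alpha> a \<in> U"
  using automorphism by (auto simp: algebra_automorphism_def bij_betw_def)

lemma \<alpha>_inj: "\<lbrakk>\<alpha> a = \<alpha> b; a \<in> U; b \<in> U\<rbrakk> \<Longrightarrow> a = b"
  using automorphism by (auto simp: algebra_automorphism_def bij_betw_def inj_on_def)

lemma \<alpha>_surj:
  assumes "b \<in> U"
  obtains a where "a \<in> U" "\<alpha> a = b"
proof -
  have "\<alpha> ` U = U"
    using automorphism by (simp only: algebra_automorphism_def bij_betw_def)
  then have "b \<in> \<alpha> ` U" using assms by (rule ssubst)
  then show thesis by (rule imageE) (rule that, assumption, rule sym)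
qed

lemma \<alpha>_compose: "\<lbrakk>a \<in> U; b \<in> U\<rbrakk> \<Longrightarrow> \<alpha> (compose (carrier M) a b) = compose (carrier M) (\<alpha> a) (\<alpha> b)"
  and \<alpha>_add: "\<lbrakk>a \<in> U; b \<in> U\<rbrakk> \<Longrightarrow>
    \<alpha> (\<lambda>u\<in>carrier M. a u \<oplus>\<^bsub>M\<^esub> b u) = (\<lambda>u\<in>carrier M. \<alpha> a u \<oplus>\<^bsub>M\<^esub> \<alpha> b u)"
  and \<alpha>_smult: "\<lbrakk>c \<in> carrier R; a \<in> U\<rbrakk> \<Longrightarrow>
    \<alpha> (\<lambda>u\<in>carrier M. c \<odot>\<^bsub>M\<^esub> a u) = (\<lambda>u\<in>carrier M. c \<odot>\<^bsub>M\<^esub> \<alpha> a u)"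
  using automorphism by (auto simp: algebra_automorphism_def)

text \<open>
  Adding a multiple of \<open>\<phi>\<close> to \<open>f\<close> produces a functional \<open>g\<close> with \<open>g e = \<one>\<close>, and
  \<open>rank_one x f\<close> is a linear combination of the finitely generated operators \<open>rank_one x g\<close>
  and \<open>rank_one x \<phi>\<close>.
\<close>

lemma rank_one_in_U [simp]:
  assumes "x \<in> carrier M" "f \<in> dual"
  shows "rank_one x f \<in> U"
proof -
  define c where "c = \<one> \<ominus> f e"
  define g where "g = (\<lambda>u. f u \<oplus> c \<otimes> \<phi> u)"
  have c: "c \<in> carrier R" using assms by (simp add: c_def)
  have g: "g \<in> dual" using assms c by (simp add: g_def dual_sum dual_scaled)
  have ge: "g e = \<one>"
    using assms by (simp add: g_def c_def R.minus_eq R.r_neg2 R.a_comm[of \<one>] R.r_neg)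
  have "rank_one x g \<in> U" "rank_one x \<phi> \<in> U"
    using rank_one_finitely_generated[OF e] assms g ge standard
    by (auto simp: standard_algebra_def)
  then have "(\<lambda>u\<in>carrier M. rank_one x g u \<oplus>\<^bsub>M\<^esub>
      (\<lambda>u\<in>carrier M. (\<ominus> c) \<odot>\<^bsub>M\<^esub> rank_one x \<phi> u) u) \<in> U" (is "?a \<in> U")
    using c by (intro U_add U_smult) auto
  also have "?a = rank_one x f"
  proof (rule lin_op_eqI[OF U_lin_op rank_one_lin_op])
    fix u assume u: "u \<in> carrier M"
    have "f u = g u \<oplus> (\<ominus> c) \<otimes> \<phi> u"
      using u c assms by (simp add: g_def R.l_minus R.a_assoc R.r_neg)
    then show "?a u = rank_one x f u"
      using u c assms g by (simp add: smult_l_distr smult_assoc1)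
  qed (use assms calculation in auto)
  finally show ?thesis .
qed

lemma q_lin_op [simp]: "q \<in> carrier (lin_ops R M)"
  by (intro U_lin_op \<alpha>_closed) simp

lemma \<alpha>_rank_one_add:
  assumes "x \<in> carrier M" "y \<in> carrier M" "f \<in> dual" "u \<in> carrier M"
  shows "\<alpha> (rank_one (x \<oplus>\<^bsub>M\<^esub> y) f) u = \<alpha> (rank_one x f) u \<oplus>\<^bsub>M\<^esub> \<alpha> (rank_one y f) u"
proof -
  have "rank_one (x \<oplus>\<^bsub>M\<^esub> y) f = (\<lambda>u\<in>carrier M. rank_one x f u \<oplus>\<^bsub>M\<^esub> rank_one y f u)"
    using assms by (auto simp: rank_one_def smult_r_distr)
  then show ?thesis using assms by (simp add: \<alpha>_add)
qed

lemma \<alpha>_rank_one_smult: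
  assumes "x \<in> carrier M" "c \<in> carrier R" "f \<in> dual" "u \<in> carrier M"
  shows "\<alpha> (rank_one (c \<odot>\<^bsub>M\<^esub> x) f) u = c \<odot>\<^bsub>M\<^esub> \<alpha> (rank_one x f) u"
proof -
  have "rank_one (c \<odot>\<^bsub>M\<^esub> x) f = (\<lambda>u\<in>carrier M. c \<odot>\<^bsub>M\<^esub> rank_one x f u)"
    using assms by (auto simp: rank_one_def R.m_comm simp flip: smult_assoc1)
  then show ?thesis using assms by (simp add: \<alpha>_smult)
qed

lemma \<alpha>_rank_one_scaled:
  assumes "x \<in> carrier M" "c \<in> carrier R" "f \<in> dual" "u \<in> carrier M"
  shows "\<alpha> (rank_one x (\<lambda>u. c \<otimes> f u)) u = c \<odot>\<^bsub>M\<^esub> \<alpha> (rank_one x f) u"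
proof -
  have "rank_one x (\<lambda>u. c \<otimes> f u) = (\<lambda>u\<in>carrier M. c \<odot>\<^bsub>M\<^esub> rank_one x f u)"
    using assms by (auto simp: rank_one_def smult_assoc1)
  then show ?thesis using assms by (simp add: \<alpha>_smult)
qed

text \<open>
  Composing with \<open>a\<close> on the left moves the vector of a rank-one operator to its image under \<open>a\<close>.
  This is the source of the relation \<open>x a = \<alpha> a x\<close> for the conjugating operator \<open>x\<close>.
\<close>

lemma \<alpha>_after_rank_one:
  assumes "a \<in> U" "x \<in> carrier M" "f \<in> dual" "u \<in> carrier M"
  shows "\<alpha> (rank_one (a x) f) u = \<alpha> a (\<alpha> (rank_one x f) u)"
proof -
  have "rank_one (a x) f = compose (carrier M) a (rank_one x f)"
    using assms by (auto simp: rank_one_def compose_def lin_op_smult U_lin_op)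
  then show ?thesis using assms by (simp add: \<alpha>_compose compose_eq)
qed

lemma q_\<alpha>_rank_one:
  assumes "h \<in> dual" "u \<in> carrier M"
  shows "q (\<alpha> (rank_one e h) u) = \<alpha> (rank_one e h) u"
proof -
  have "q (\<alpha> (rank_one e h) u) = \<alpha> (rank_one (p e) h) u"
    using assms by (intro \<alpha>_after_rank_one[symmetric]) simp_all
  then show ?thesis by simp
qed

lemma \<alpha>_rank_one_q:
  assumes "x \<in> carrier M" "u \<in> carrier M"
  shows "\<alpha> (rank_one x \<phi>) (q u) = \<alpha> (rank_one x \<phi>) u"
proof -
  have "\<alpha> (rank_one x \<phi>) (q u) = \<alpha> (rank_one (rank_one x \<phi> e) \<phi>) u"
    using assms by (intro \<alpha>_after_rank_one[symmetric]) simp_all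
  then show ?thesis using assms by simp
qed

text \<open>
  The idempotent \<open>p\<close> has no annihilator because \<open>\<phi> (p e) = \<one>\<close>, and \<open>\<alpha>\<close> carries this over to \<open>q\<close>.
\<close>

lemma q_faithful:
  assumes c: "c \<in> carrier R" and "\<And>u. u \<in> carrier M \<Longrightarrow> c \<odot>\<^bsub>M\<^esub> q u = \<zero>\<^bsub>M\<^esub>"
  shows "c = \<zero>"
proof -
  have "\<alpha> (\<lambda>u\<in>carrier M. c \<odot>\<^bsub>M\<^esub> p u) = \<alpha> (\<lambda>u\<in>carrier M. \<zero> \<odot>\<^bsub>M\<^esub> p u)"
    using assms by (auto simp: \<alpha>_smult simp del: rank_one_apply)
  then have "(\<lambda>u\<in>carrier M. c \<odot>\<^bsub>M\<^esub> p u) = (\<lambda>u\<in>carrier M. \<zero> \<odot>\<^bsub>M\<^esub> p u)"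
    by (rule \<alpha>_inj) (simp_all only: U_smult c R.zero_closed rank_one_in_U e \<phi>)
  from fun_cong[OF this, of e] have "c \<odot>\<^bsub>M\<^esub> e = \<zero> \<odot>\<^bsub>M\<^esub> e" using c by simp
  then have "\<phi> (c \<odot>\<^bsub>M\<^esub> e) = \<phi> (\<zero> \<odot>\<^bsub>M\<^esub> e)" by simp
  then show ?thesis using c by (subst (asm) (1 2) dual_smult) auto
qed

text \<open>
  The corner \<open>p U p\<close> consists of the multiples of \<open>p\<close>, since \<open>p a p = \<phi> (a e) p\<close>; hence \<open>q U q\<close>
  consists of the multiples of \<open>q\<close>.
\<close>

lemma corner_scalar:
  assumes "b \<in> U"
  obtains c where "c \<in> carrier R" "\<And>u. u \<in> carrier M \<Longrightarrow> q (b (q u)) = c \<odot>\<^bsub>M\<^esub> q u"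
proof -
  obtain a where a: "a \<in> U" "\<alpha> a = b" using \<alpha>_surj[OF assms] .
  have ae: "a e \<in> carrier M" using a by (simp add: U_lin_op)
  show thesis
  proof
    show "\<phi> (a e) \<in> carrier R" using ae by simp
    fix u assume u: "u \<in> carrier M"
    have "q (b (q u)) = q (\<alpha> (rank_one (a e) \<phi>) u)"
      using \<alpha>_after_rank_one[of a e \<phi> u] a u by simp
    also have "\<dots> = \<alpha> (rank_one (\<phi> (a e) \<odot>\<^bsub>M\<^esub> e) \<phi>) u"
      using \<alpha>_after_rank_one[of p "a e" \<phi> u] ae u by simp
    also have "\<dots> = \<phi> (a e) \<odot>\<^bsub>M\<^esub> q u" using ae u by (simp add: \<alpha>_rank_one_smult)
    finally show "q (b (q u)) = \<phi> (a e) \<odot>\<^bsub>M\<^esub> q u" .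
  qed
qed

text \<open>
  The element of the corner of \<open>q\<close> given by \<open>rank_one z f\<close> is a multiple of \<open>q\<close>, and it fixes
  \<open>z\<close>, on which \<open>f\<close> takes the value \<open>\<one>\<close>; so the factor is \<open>\<one>\<close>. Thus \<open>z\<close> is a basis of the
  range of \<open>q\<close>.
\<close>

lemma q_range_generated:
  assumes z: "z \<in> carrier M" "q z = z" and f: "f \<in> dual" "f z = \<one>" and u: "u \<in> carrier M"
  shows "q u = f (q u) \<odot>\<^bsub>M\<^esub> z"
proof -
  obtain c where c: "c \<in> carrier R"
      "\<And>u. u \<in> carrier M \<Longrightarrow> q (rank_one z f (q u)) = c \<odot>\<^bsub>M\<^esub> q u"
    using corner_scalar[of "rank_one z f"] z f by auto
  have scalar: "f (q u) \<odot>\<^bsub>M\<^esub> z = c \<odot>\<^bsub>M\<^esub> q u" if "u \<in> carrier M" for u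
    using c(2)[OF that] that z f by (simp add: lin_op_smult)
  have "c = \<one>"
    using arg_cong[OF scalar[of z], of f] z f c by (simp add: dual_smult)
  then show ?thesis using scalar[OF u] u by simp
qed

text \<open>
  The conjugating operator is \<open>x y = \<alpha> (rank_one y \<phi>) z\<close>. It is injective because \<open>z\<close> generates
  the range of \<open>q\<close>, through which \<open>\<alpha> (rank_one y \<phi>)\<close> factors: the vector \<open>x y\<close> determines that
  operator, hence \<open>y\<close>. It is surjective because \<open>rank_one w f\<close> sends \<open>z = x e\<close> to \<open>w\<close>.
\<close>

theorem spatial_if_q_range_has_unimodular:
  assumes z: "z \<in> carrier M" "q z = z" and f: "f \<in> dual" "f z = \<one>"
  shows "spatial_on (lin_ops R M) U \<alpha>"
proof -
  define x where "x = (\<lambda>y\<in>carrier M. \<alpha> (rank_one y \<phi>) z)"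
  have x_lin: "x \<in> carrier (lin_ops R M)"
  proof (rule lin_opI)
    show "x \<in> extensional (carrier M)" by (simp add: x_def)
    have closed: "\<alpha> (rank_one u \<phi>) z \<in> carrier M" if "u \<in> carrier M" for u
      by (rule lin_op_closed[OF U_lin_op[OF \<alpha>_closed[OF rank_one_in_U]]]) (simp_all add: that z)
    fix u assume u: "u \<in> carrier M"
    show "x u \<in> carrier M" using closed[OF u] u by (simp add: x_def)
    fix v assume v: "v \<in> carrier M"
    show "x (u \<oplus>\<^bsub>M\<^esub> v) = x u \<oplus>\<^bsub>M\<^esub> x v"
      using \<alpha>_rank_one_add[OF u v \<phi> z(1)] u v by (simp add: x_def)
  next
    fix c u assume cu: "c \<in> carrier R" "u \<in> carrier M"
    show "x (c \<odot>\<^bsub>M\<^esub> u) = c \<odot>\<^bsub>M\<^esub> x u"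
      using \<alpha>_rank_one_smult[OF cu(2,1) \<phi> z(1)] cu by (simp add: x_def)
  qed
  have intertwine: "x (a y) = \<alpha> a (x y)" if "a \<in> U" "y \<in> carrier M" for a y
    using \<alpha>_after_rank_one[OF that \<phi> z(1)] that by (simp add: x_def U_lin_op)
  have "inj_on x (carrier M)"
  proof (rule inj_onI)
    fix y y' assume y: "y \<in> carrier M" "y' \<in> carrier M" and eq: "x y = x y'"
    \<comment> \<open>the operator \<open>\<alpha> (rank_one v \<phi>)\<close> factors through \<open>q\<close>, so it is determined by \<open>x v\<close>\<close>
    have factor: "\<alpha> (rank_one v \<phi>) u = f (q u) \<odot>\<^bsub>M\<^esub> x v" if "u \<in> carrier M" "v \<in> carrier M" for u v
    proof -
      have "\<alpha> (rank_one v \<phi>) u = \<alpha> (rank_one v \<phi>) (f (q u) \<odot>\<^bsub>M\<^esub> z)"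
        using \<alpha>_rank_one_q q_range_generated[OF z f] that by simp
      then show ?thesis using that z f by (simp add: lin_op_smult U_lin_op x_def)
    qed
    have "\<alpha> (rank_one y \<phi>) = \<alpha> (rank_one y' \<phi>)"
    proof (rule lin_op_eqI[OF U_lin_op U_lin_op])
      fix u assume "u \<in> carrier M"
      then show "\<alpha> (rank_one y \<phi>) u = \<alpha> (rank_one y' \<phi>) u"
        by (simp only: factor[OF _ y(1)] factor[OF _ y(2)] eq)
    qed (use y in simp_all)
    then have "rank_one y \<phi> = rank_one y' \<phi>" by (rule \<alpha>_inj) (use y in simp_all)
    from fun_cong[OF this, of e] show "y = y'" using y by simp
  qed
  moreover have "w \<in> x ` carrier M" if w: "w \<in> carrier M" for w
  proof -
    obtain b where b: "b \<in> U" "\<alpha> b = rank_one w f"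
      using \<alpha>_surj[of "rank_one w f"] w f by auto
    \<comment> \<open>\<open>x (b e) = \<alpha> b (x e)\<close>, and \<open>x e = q z = z\<close>\<close>
    have "x (b e) = w" using intertwine[of b e] b z f w by (simp add: x_def)
    then show ?thesis using b by (intro image_eqI[of _ _ "b e"]) (simp_all add: U_lin_op)
  qed
  ultimately have "bij_betw x (carrier M) (carrier M)"
    using x_lin by (auto simp: bij_betw_def)
  then have x: "x \<in> Units (lin_ops R M)" by (rule bij_lin_op_Units[OF x_lin])
  interpret L: monoid "lin_ops R M" by (rule lin_ops_monoid)
  have "\<alpha> a = x \<otimes>\<^bsub>lin_ops R M\<^esub> a \<otimes>\<^bsub>lin_ops R M\<^esub> inv\<^bsub>lin_ops R M\<^esub> x" if a: "a \<in> U" for a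
  proof -
    have "x \<otimes>\<^bsub>lin_ops R M\<^esub> a = \<alpha> a \<otimes>\<^bsub>lin_ops R M\<^esub> x"
      using intertwine[OF a] by (auto simp: compose_def)
    then have "x \<otimes>\<^bsub>lin_ops R M\<^esub> a \<otimes>\<^bsub>lin_ops R M\<^esub> inv\<^bsub>lin_ops R M\<^esub> x =
        \<alpha> a \<otimes>\<^bsub>lin_ops R M\<^esub> (x \<otimes>\<^bsub>lin_ops R M\<^esub> inv\<^bsub>lin_ops R M\<^esub> x)"
      using a x by (simp only: L.m_assoc U_lin_op \<alpha>_closed L.Units_closed L.Units_inv_closed)
    then show ?thesis
      using a x by (simp only: L.Units_r_inv L.r_one U_lin_op \<alpha>_closed)
  qed
  then show ?thesis unfolding spatial_on_def using x by blast
qed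

text \<open>
  If \<open>\<alpha> b = rank_one w \<phi>\<close> and \<open>q w = w\<close>, then \<open>p b = b\<close>, so \<open>b\<close> is \<open>rank_one e h\<close> with
  \<open>h = \<phi> \<circ> b\<close>.
\<close>

lemma coordinate_functional:
  assumes w: "w \<in> carrier M" "q w = w"
  obtains h where "h \<in> dual" "\<alpha> (rank_one e h) e = w"
proof -
  obtain b where b: "b \<in> U" "\<alpha> b = rank_one w \<phi>"
    using \<alpha>_surj[of "rank_one w \<phi>"] w by auto
  define h where "h = (\<lambda>y. \<phi> (b y))"
  have h: "h \<in> dual"
    using U_lin_op[OF b(1)]
    by (intro dualI) (simp_all add: h_def lin_op_add lin_op_smult dual_add dual_smult)
  have "rank_one e h = compose (carrier M) p b"
    using b by (auto simp: rank_one_def compose_def h_def U_lin_op)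
  then have "\<alpha> (rank_one e h) e = w"
    using w b by (simp add: \<alpha>_compose compose_eq)
  with h show thesis by (rule that)
qed

text \<open>
  Whatever gluing the dual admits, the range of \<open>q\<close> inherits through the map
  \<open>h \<mapsto> \<alpha> (rank_one e h) e\<close>, which is \<open>R\<close>-linear and maps onto that range. In the application
  the \<open>s n\<close> are indicators of disjoint sets.
\<close>

lemma q_range_glue:
  assumes w: "\<And>n. w n \<in> carrier M" "\<And>n. q (w n) = w n" and s: "\<And>n. s n \<in> carrier R"
    and glue: "\<And>h. (\<And>n. h n \<in> dual) \<Longrightarrow>
      \<exists>g\<in>dual. \<forall>n. \<forall>y\<in>carrier M. s n \<otimes> g y = s n \<otimes> h n y"
  obtains z where "z \<in> carrier M" "q z = z" "\<And>n. s n \<odot>\<^bsub>M\<^esub> z = s n \<odot>\<^bsub>M\<^esub> w n"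
proof -
  have "\<exists>h. h \<in> dual \<and> \<alpha> (rank_one e h) e = w n" for n
    using coordinate_functional[OF w(1)[of n] w(2)[of n]] by blast
  then obtain h where h: "\<And>n. h n \<in> dual" "\<And>n. \<alpha> (rank_one e (h n)) e = w n" by metis
  from glue[of h] h(1) obtain g where
    g: "g \<in> dual" "\<And>n y. y \<in> carrier M \<Longrightarrow> s n \<otimes> g y = s n \<otimes> h n y" by blast
  show thesis
  proof
    show "\<alpha> (rank_one e g) e \<in> carrier M" using g by (simp add: U_lin_op)
    show "q (\<alpha> (rank_one e g) e) = \<alpha> (rank_one e g) e" using g by (simp add: q_\<alpha>_rank_one)
    fix n
    have "rank_one e (\<lambda>u. s n \<otimes> g u) = rank_one e (\<lambda>u. s n \<otimes> h n u)"
      using g by (auto simp: rank_one_def)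
    then show "s n \<odot>\<^bsub>M\<^esub> \<alpha> (rank_one e g) e = s n \<odot>\<^bsub>M\<^esub> w n"
      using \<alpha>_rank_one_scaled[of e "s n" g e] \<alpha>_rank_one_scaled[of e "s n" "h n" e] g h s by simp
  qed
qed

end

section \<open>Exhaustion in a finite measure space\<close>

text \<open>
  The supremum of the measures is attained at an upper bound \<open>T\<close> of a maximizing sequence, and a
  member that exceeded \<open>T\<close> on a set of positive measure would have, together with \<open>T\<close>, an upper
  bound of larger measure.
\<close>

lemma (in finite_measure) ex_AE_largest_set:
  assumes ne: "\<G> \<noteq> {}" and sets: "\<G> \<subseteq> sets M"
    and upper: "\<And>S :: nat \<Rightarrow> 'a set. (\<And>n. S n \<in> \<G>) \<Longrightarrow> \<exists>T\<in>\<G>. AE \<omega> in M. \<forall>n. \<omega> \<in> S n \<longrightarrow> \<omega> \<in> T"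
  shows "\<exists>T\<in>\<G>. \<forall>S\<in>\<G>. AE \<omega> in M. \<omega> \<in> S \<longrightarrow> \<omega> \<in> T"
proof -
  define c where "c = (SUP S\<in>\<G>. measure M S)"
  have bdd: "bdd_above (measure M ` \<G>)" by (rule bdd_aboveI2[OF bounded_measure])
  have "\<exists>S\<in>\<G>. c - 1 / real (Suc n) < measure M S" for n
    using ne less_cSUP_iff[OF ne bdd, of "c - 1 / real (Suc n)"] unfolding c_def by simp
  then obtain S where S: "\<And>n. S n \<in> \<G>" "\<And>n. c - 1 / real (Suc n) < measure M (S n)" by metis
  obtain T where T: "T \<in> \<G>" "AE \<omega> in M. \<forall>n. \<omega> \<in> S n \<longrightarrow> \<omega> \<in> T" using upper[of S] S(1) by blast
  have "measure M (S n) \<le> measure M T" for n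
    using T sets by (intro finite_measure_mono_AE) auto
  then have T_ge: "c - 1 / real (Suc n) \<le> measure M T" for n
    using S(2)[of n] by (meson less_le_trans less_imp_le)
  have "(\<lambda>n. c - 1 / real (Suc n)) \<longlonglongrightarrow> c - 0"
    by (intro tendsto_diff tendsto_const LIMSEQ_Suc[OF lim_1_over_n])
  then have cT: "c \<le> measure M T"
    by (intro LIMSEQ_le_const2[where X = "\<lambda>n. c - 1 / real (Suc n)"]) (auto simp del: of_nat_Suc intro: T_ge)
  have "AE \<omega> in M. \<omega> \<in> B \<longrightarrow> \<omega> \<in> T" if B: "B \<in> \<G>" for B
  proof -
    have "\<exists>T'\<in>\<G>. AE \<omega> in M. \<forall>n. \<omega> \<in> (if n = (0::nat) then T else B) \<longrightarrow> \<omega> \<in> T'"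
      by (rule upper) (simp add: T(1) B)
    then obtain T' where T': "T' \<in> \<G>"
      "AE \<omega> in M. \<forall>n. \<omega> \<in> (if n = (0::nat) then T else B) \<longrightarrow> \<omega> \<in> T'" by blast
    have "AE \<omega> in M. \<omega> \<in> T \<union> B \<longrightarrow> \<omega> \<in> T'"
      using T'(2) by eventually_elim (metis Un_iff zero_neq_one)
    then have "measure M (T \<union> B) \<le> measure M T'"
      using T'(1) sets by (intro finite_measure_mono_AE) auto
    also have "measure M T' \<le> c" unfolding c_def by (rule cSUP_upper[OF T'(1) bdd])
    finally have "measure M (T \<union> B) \<le> measure M T" using cT by simp
    moreover have "measure M (T \<union> B) = measure M T + measure M (B - T)"
      using T(1) B sets by (intro finite_measure_Union') auto
    ultimately have "measure M (B - T) = 0"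
      using measure_nonneg[of M "B - T"] by simp
    then have "B - T \<in> null_sets M"
      using B T(1) sets by (auto simp: null_sets_def emeasure_eq_measure)
    from AE_not_in[OF this] show ?thesis by eventually_elim auto
  qed
  with T(1) show ?thesis by blast
qed

section \<open>Calculating in \<open>L0\<close> with representatives\<close>

lemma L0_class_closed [simp]: "f \<in> borel_measurable M \<Longrightarrow> L0_class M f \<in> carrier (L0 M)"
  by (simp add: L0_def)

lemma L0_carrierE:
  assumes "F \<in> carrier (L0 M)"
  obtains f where "f \<in> borel_measurable M" "F = L0_class M f"
  using assms by (auto simp: L0_def)

lemma L0_rep_measurable [measurable]: "F \<in> carrier (L0 M) \<Longrightarrow> L0_rep F \<in> borel_measurable M"
  by (elim L0_carrierE) (simp add: L0_rep_class)

lemma L0_eqI: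
  assumes "F \<in> carrier (L0 M)" "G \<in> carrier (L0 M)" "AE \<omega> in M. L0_rep F \<omega> = L0_rep G \<omega>"
  shows "F = G"
proof -
  obtain f g where f: "f \<in> borel_measurable M" "F = L0_class M f"
    and g: "g \<in> borel_measurable M" "G = L0_class M g"
    using assms(1,2) by (elim L0_carrierE)
  have "AE \<omega> in M. f \<omega> = g \<omega>"
    using assms(3) L0_rep_class(2)[OF f(1)] L0_rep_class(2)[OF g(1)]
    unfolding f(2) g(2) by eventually_elim simp
  then show ?thesis unfolding f(2) g(2) by (rule L0_class_eqI)
qed

lemma AE_L0_zero: "AE \<omega> in M. L0_rep \<zero>\<^bsub>L0 M\<^esub> \<omega> = 0"
  using L0_rep_class(2)[of "\<lambda>_. 0" M] by (simp add: L0_def)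

lemma AE_L0_one: "AE \<omega> in M. L0_rep \<one>\<^bsub>L0 M\<^esub> \<omega> = 1"
  using L0_rep_class(2)[of "\<lambda>_. 1" M] by (simp add: L0_def)

lemma AE_L0_mult:
  assumes "F \<in> carrier (L0 M)" "G \<in> carrier (L0 M)"
  shows "AE \<omega> in M. L0_rep (F \<otimes>\<^bsub>L0 M\<^esub> G) \<omega> = L0_rep F \<omega> * L0_rep G \<omega>"
  using L0_rep_class(2)[of "\<lambda>\<omega>. L0_rep F \<omega> * L0_rep G \<omega>" M] assms
  by (simp add: L0_def[of M] L0_rep_measurable[unfolded L0_def] borel_measurable_times)

lemma AE_L0_add:
  assumes "F \<in> carrier (L0 M)" "G \<in> carrier (L0 M)"
  shows "AE \<omega> in M. L0_rep (F \<oplus>\<^bsub>L0 M\<^esub> G) \<omega> = L0_rep F \<omega> + L0_rep G \<omega>"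
  using L0_rep_class(2)[of "\<lambda>\<omega>. L0_rep F \<omega> + L0_rep G \<omega>" M] assms
  by (simp add: L0_def[of M] L0_rep_measurable[unfolded L0_def] borel_measurable_add)

lemma AE_L0_cnj:
  assumes "F \<in> carrier (L0 M)"
  shows "AE \<omega> in M. L0_rep (L0_map M cnj F) \<omega> = cnj (L0_rep F \<omega>)"
proof -
  have "(\<lambda>\<omega>. cnj (L0_rep F \<omega>)) \<in> borel_measurable M"
    using L0_rep_measurable[OF assms]
    by (rule measurable_compose) (intro borel_measurable_continuous_onI continuous_intros)
  then show ?thesis unfolding L0_map_def by (rule L0_rep_class)
qed

definition L0_glue :: "'w measure \<Rightarrow> ('w \<Rightarrow> nat) \<Rightarrow> (nat \<Rightarrow> 'w L0) \<Rightarrow> 'w L0" where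
  "L0_glue M k F = L0_class M (\<lambda>\<omega>. L0_rep (F (k \<omega>)) \<omega>)"

lemma
  assumes k: "k \<in> measurable M (count_space UNIV)" and F: "\<And>n. F n \<in> carrier (L0 M)"
  shows L0_glue_closed: "L0_glue M k F \<in> carrier (L0 M)"
    and AE_L0_glue: "AE \<omega> in M. L0_rep (L0_glue M k F) \<omega> = L0_rep (F (k \<omega>)) \<omega>"
proof -
  have "(\<lambda>\<omega>. L0_rep (F (k \<omega>)) \<omega>) \<in> borel_measurable M"
    by (rule measurable_compose_countable[OF L0_rep_measurable[OF F] k])
  then show "L0_glue M k F \<in> carrier (L0 M)"
    and "AE \<omega> in M. L0_rep (L0_glue M k F) \<omega> = L0_rep (F (k \<omega>)) \<omega>"
    unfolding L0_glue_def by (rule L0_class_closed, rule L0_rep_class(2))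
qed

abbreviation L0_indicator :: "'w measure \<Rightarrow> 'w set \<Rightarrow> 'w L0" where
  "L0_indicator M A \<equiv> L0_class M (indicator A)"

lemma AE_L0_indicator: "A \<in> sets M \<Longrightarrow> AE \<omega> in M. L0_rep (L0_indicator M A) \<omega> = indicator A \<omega>"
  by (rule L0_rep_class(2)) simp

section \<open>Automorphisms over \<open>L0\<close>\<close>

text \<open>
  Here \<open>N\<close> stands for the submodule \<open>D\<close> with the inner product inherited from the
  Kaplansky--Hilbert module.
\<close>

locale L0_standard_automorphism =
  finite_measure M + standard_automorphism "L0 M" N e "\<lambda>u. ip u e" U \<alpha>
  for M :: "'w measure" and N :: "('w L0, 'x, 'm) module_scheme"
    and ip :: "'x \<Rightarrow> 'x \<Rightarrow> 'w L0" and e U \<alpha> +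
  assumes ip_closed [simp]: "\<lbrakk>x \<in> carrier N; y \<in> carrier N\<rbrakk> \<Longrightarrow> ip x y \<in> carrier (L0 M)"
    and ip_definite: "\<lbrakk>x \<in> carrier N; ip x x = \<zero>\<^bsub>L0 M\<^esub>\<rbrakk> \<Longrightarrow> x = \<zero>\<^bsub>N\<^esub>"
    and ip_cnj: "\<lbrakk>x \<in> carrier N; y \<in> carrier N\<rbrakk> \<Longrightarrow> ip x y = L0_map M cnj (ip y x)"
    and ip_add: "\<lbrakk>x \<in> carrier N; y \<in> carrier N; z \<in> carrier N\<rbrakk> \<Longrightarrow>
          ip (x \<oplus>\<^bsub>N\<^esub> y) z = ip x z \<oplus>\<^bsub>L0 M\<^esub> ip y z"
    and ip_smult: "\<lbrakk>a \<in> carrier (L0 M); x \<in> carrier N; y \<in> carrier N\<rbrakk> \<Longrightarrow>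
          ip (a \<odot>\<^bsub>N\<^esub> x) y = a \<otimes>\<^bsub>L0 M\<^esub> ip x y"
begin

lemma ip_dual: "y \<in> carrier N \<Longrightarrow> (\<lambda>u. ip u y) \<in> dual"
  by (rule dualI) (simp_all add: ip_add ip_smult)

lemma AE_ip_scaled:
  assumes c: "c \<in> carrier (L0 M)" and x: "x \<in> carrier N"
  shows "AE \<omega> in M. L0_rep (ip (c \<odot>\<^bsub>N\<^esub> x) (c \<odot>\<^bsub>N\<^esub> x)) \<omega> =
    L0_rep c \<omega> * cnj (L0_rep c \<omega>) * L0_rep (ip x x) \<omega>"
proof -
  have cx: "c \<odot>\<^bsub>N\<^esub> x \<in> carrier N" using c x by simp
  have eq: "ip (c \<odot>\<^bsub>N\<^esub> x) (c \<odot>\<^bsub>N\<^esub> x) = c \<otimes>\<^bsub>L0 M\<^esub> L0_map M cnj (c \<otimes>\<^bsub>L0 M\<^esub> ip x x)"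
    by (subst ip_smult[OF c x cx], subst ip_cnj[OF x cx], subst ip_smult[OF c x x]) (rule refl)
  have "L0_map M cnj (c \<otimes>\<^bsub>L0 M\<^esub> ip x x) = ip x (c \<odot>\<^bsub>N\<^esub> x)"
    by (subst ip_cnj[OF x cx], subst ip_smult[OF c x x]) (rule refl)
  then have closed: "L0_map M cnj (c \<otimes>\<^bsub>L0 M\<^esub> ip x x) \<in> carrier (L0 M)" using x cx by simp
  have cnj_xx: "L0_map M cnj (ip x x) = ip x x" by (rule ip_cnj[OF x x, symmetric])
  have "AE \<omega> in M. L0_rep (ip x x) \<omega> = cnj (L0_rep (ip x x) \<omega>)"
    using AE_L0_cnj[OF ip_closed[OF x x]] unfolding cnj_xx .
  then show ?thesis
    using AE_L0_mult[OF c closed] AE_L0_cnj[OF R.m_closed[OF c ip_closed[OF x x]]]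
      AE_L0_mult[OF c ip_closed[OF x x]]
    unfolding eq by eventually_elim (simp add: mult.assoc)
qed

text \<open>
  This is where the dual is larger than the module: vectors cannot be glued in general, but a
  functional is glued through its values.
\<close>

lemma dual_glue:
  assumes k: "k \<in> measurable M (count_space UNIV)" and h: "\<And>n. h n \<in> dual"
  shows "(\<lambda>y. L0_glue M k (\<lambda>n. h n y)) \<in> dual"
proof (rule dualI)
  have closed: "L0_glue M k (\<lambda>n. h n y) \<in> carrier (L0 M)"
    and AE_glue: "AE \<omega> in M. L0_rep (L0_glue M k (\<lambda>n. h n y)) \<omega> = L0_rep (h (k \<omega>) y) \<omega>"
    if "y \<in> carrier N" for y
    using L0_glue_closed[OF k, of "\<lambda>n. h n y"] AE_L0_glue[OF k, of "\<lambda>n. h n y"] h that by simp_all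
  fix x assume x: "x \<in> carrier N"
  show "L0_glue M k (\<lambda>n. h n x) \<in> carrier (L0 M)" by (rule closed[OF x])
  {
    fix y assume y: "y \<in> carrier N"
    have xy: "x \<oplus>\<^bsub>N\<^esub> y \<in> carrier N" using x y by simp
    show "L0_glue M k (\<lambda>n. h n (x \<oplus>\<^bsub>N\<^esub> y)) =
        L0_glue M k (\<lambda>n. h n x) \<oplus>\<^bsub>L0 M\<^esub> L0_glue M k (\<lambda>n. h n y)"
    proof (rule L0_eqI[OF closed[OF xy] R.a_closed[OF closed[OF x] closed[OF y]]])
      have "AE \<omega> in M. L0_rep (h n (x \<oplus>\<^bsub>N\<^esub> y)) \<omega> = L0_rep (h n x) \<omega> + L0_rep (h n y) \<omega>" for n
        unfolding dual_add[OF h x y] by (rule AE_L0_add[OF dual_closed[OF h x] dual_closed[OF h y]])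
      then have "AE \<omega> in M. \<forall>n. L0_rep (h n (x \<oplus>\<^bsub>N\<^esub> y)) \<omega> = L0_rep (h n x) \<omega> + L0_rep (h n y) \<omega>"
        by (simp add: AE_all_countable)
      with AE_glue[OF x] AE_glue[OF y] AE_glue[OF xy] AE_L0_add[OF closed[OF x] closed[OF y]]
      show "AE \<omega> in M. L0_rep (L0_glue M k (\<lambda>n. h n (x \<oplus>\<^bsub>N\<^esub> y))) \<omega> =
          L0_rep (L0_glue M k (\<lambda>n. h n x) \<oplus>\<^bsub>L0 M\<^esub> L0_glue M k (\<lambda>n. h n y)) \<omega>"
        by eventually_elim simp
    qed
  }
  {
    fix c assume c: "c \<in> carrier (L0 M)"
    have cx: "c \<odot>\<^bsub>N\<^esub> x \<in> carrier N" using c x by simp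
    show "L0_glue M k (\<lambda>n. h n (c \<odot>\<^bsub>N\<^esub> x)) = c \<otimes>\<^bsub>L0 M\<^esub> L0_glue M k (\<lambda>n. h n x)"
    proof (rule L0_eqI[OF closed[OF cx] R.m_closed[OF c closed[OF x]]])
      have "AE \<omega> in M. L0_rep (h n (c \<odot>\<^bsub>N\<^esub> x)) \<omega> = L0_rep c \<omega> * L0_rep (h n x) \<omega>" for n
        unfolding dual_smult[OF h c x] by (rule AE_L0_mult[OF c dual_closed[OF h x]])
      then have "AE \<omega> in M. \<forall>n. L0_rep (h n (c \<odot>\<^bsub>N\<^esub> x)) \<omega> = L0_rep c \<omega> * L0_rep (h n x) \<omega>"
        by (simp add: AE_all_countable)
      with AE_glue[OF x] AE_glue[OF cx] AE_L0_mult[OF c closed[OF x]]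
      show "AE \<omega> in M. L0_rep (L0_glue M k (\<lambda>n. h n (c \<odot>\<^bsub>N\<^esub> x))) \<omega> =
          L0_rep (c \<otimes>\<^bsub>L0 M\<^esub> L0_glue M k (\<lambda>n. h n x)) \<omega>"
        by eventually_elim simp
    qed
  }
qed

text \<open>
  The vector \<open>z\<close> glues the parts of the \<open>w n\<close> on the sets where \<open>k\<close> takes the value \<open>n\<close>. The
  conclusion expresses this through \<open>ip z z\<close>, which determines the support of \<open>z\<close>.
\<close>

lemma q_range_mixing:
  fixes k :: "'w \<Rightarrow> nat"
  assumes w: "\<And>n. w n \<in> carrier N" "\<And>n. q (w n) = w n"
    and k: "k \<in> measurable M (count_space UNIV)"
  obtains z where "z \<in> carrier N" "q z = z"
    "AE \<omega> in M. L0_rep (ip z z) \<omega> = L0_rep (ip (w (k \<omega>)) (w (k \<omega>))) \<omega>"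
proof -
  define A where "A n = k -` {n} \<inter> space M" for n
  have A: "A n \<in> sets M" for n unfolding A_def by (rule measurable_sets[OF k]) simp
  have s: "L0_indicator M (A n) \<in> carrier (L0 M)" for n using A by simp
  have "\<exists>g\<in>dual. \<forall>n. \<forall>y\<in>carrier N.
      L0_indicator M (A n) \<otimes>\<^bsub>L0 M\<^esub> g y = L0_indicator M (A n) \<otimes>\<^bsub>L0 M\<^esub> h n y"
    if h: "\<And>n. h n \<in> dual" for h
  proof (intro bexI allI ballI)
    show g: "(\<lambda>y. L0_glue M k (\<lambda>n. h n y)) \<in> dual" by (rule dual_glue[OF k h])
    fix n y assume y: "y \<in> carrier N"
    note gy = dual_closed[OF g y] and hy = dual_closed[OF h y]
    show "L0_indicator M (A n) \<otimes>\<^bsub>L0 M\<^esub> L0_glue M k (\<lambda>n. h n y) =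
        L0_indicator M (A n) \<otimes>\<^bsub>L0 M\<^esub> h n y"
      using AE_L0_mult[OF s[of n] gy] AE_L0_mult[OF s[of n] hy[of n]] AE_L0_glue[OF k, of "\<lambda>n. h n y", OF hy]
        AE_L0_indicator[OF A[of n]]
      by (intro L0_eqI[OF R.m_closed[OF s gy] R.m_closed[OF s hy]], eventually_elim)
        (auto simp: A_def indicator_def)
  qed
  from q_range_glue[of w, OF w s this] obtain z where z: "z \<in> carrier N" "q z = z"
    and zw: "\<And>n. L0_indicator M (A n) \<odot>\<^bsub>N\<^esub> z = L0_indicator M (A n) \<odot>\<^bsub>N\<^esub> w n"
    by blast
  have "AE \<omega> in M. \<omega> \<in> A n \<longrightarrow> L0_rep (ip z z) \<omega> = L0_rep (ip (w n) (w n)) \<omega>" for n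
    using AE_ip_scaled[OF s z(1), of n] AE_ip_scaled[OF s w(1), of n n] AE_L0_indicator[OF A[of n]]
    unfolding zw by eventually_elim auto
  then have "AE \<omega> in M. \<forall>n. \<omega> \<in> A n \<longrightarrow> L0_rep (ip z z) \<omega> = L0_rep (ip (w n) (w n)) \<omega>"
    by (simp add: AE_all_countable)
  then have "AE \<omega> in M. L0_rep (ip z z) \<omega> = L0_rep (ip (w (k \<omega>)) (w (k \<omega>))) \<omega>"
    using AE_space by eventually_elim (simp add: A_def)
  with z show thesis by (rule that)
qed

text \<open>
  The supports of vectors in the range of \<open>q\<close> are closed under countable unions by mixing, so there
  is a largest one. Its complement has an indicator that annihilates \<open>q\<close>, hence is null.
\<close>

lemma q_range_full_support:
  obtains z where "z \<in> carrier N" "q z = z" "AE \<omega> in M. L0_rep (ip z z) \<omega> \<noteq> 0"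
proof -
  define supp where "supp z = {\<omega> \<in> space M. L0_rep (ip z z) \<omega> \<noteq> 0}" for z
  define \<G> where "\<G> = supp ` {z \<in> carrier N. q z = z}"
  have supp_sets: "supp z \<in> sets M" if "z \<in> carrier N" for z
    using L0_rep_measurable[OF ip_closed[OF that that]] unfolding supp_def by measurable
  have q_range: "q (q u) = q u" "q u \<in> carrier N" if "u \<in> carrier N" for u
    using q_\<alpha>_rank_one[OF \<phi> that] that by simp_all
  have "\<exists>T\<in>\<G>. \<forall>S\<in>\<G>. AE \<omega> in M. \<omega> \<in> S \<longrightarrow> \<omega> \<in> T"
  proof (rule ex_AE_largest_set)
    show "\<G> \<noteq> {}" using q_range[OF e] by (auto simp: \<G>_def intro!: exI[of _ "q e"])
    show "\<G> \<subseteq> sets M" by (auto simp: \<G>_def supp_sets)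
    fix S :: "nat \<Rightarrow> 'w set" assume "\<And>n. S n \<in> \<G>"
    then have "\<forall>n. \<exists>w. w \<in> carrier N \<and> q w = w \<and> S n = supp w" by (auto simp: \<G>_def)
    then obtain w where w: "\<And>n. w n \<in> carrier N" "\<And>n. q (w n) = w n" "\<And>n. S n = supp (w n)"
      by metis
    \<comment> \<open>where all \<open>w n\<close> vanish, the value of \<open>k\<close> is arbitrary, as \<open>S n\<close> contains no such point\<close>
    define k where "k \<omega> = (LEAST n. L0_rep (ip (w n) (w n)) \<omega> \<noteq> 0)" for \<omega>
    have "k \<in> measurable M (count_space UNIV)"
      unfolding k_def
    proof (rule measurable_Least)
      fix n show "Measurable.pred M (\<lambda>\<omega>. L0_rep (ip (w n) (w n)) \<omega> \<noteq> 0)"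
        using L0_rep_measurable[OF ip_closed[OF w(1)[of n] w(1)[of n]]] by measurable
    qed
    then obtain z where z: "z \<in> carrier N" "q z = z"
      "AE \<omega> in M. L0_rep (ip z z) \<omega> = L0_rep (ip (w (k \<omega>)) (w (k \<omega>))) \<omega>"
      by (rule q_range_mixing[OF w(1,2)])
    have "AE \<omega> in M. \<forall>n. \<omega> \<in> S n \<longrightarrow> \<omega> \<in> supp z"
      using z(3)
    proof eventually_elim
      case (elim \<omega>)
      then show ?case
        using LeastI[of "\<lambda>n. L0_rep (ip (w n) (w n)) \<omega> \<noteq> 0"] by (auto simp: w(3) supp_def k_def)
    qed
    then show "\<exists>T\<in>\<G>. AE \<omega> in M. \<forall>n. \<omega> \<in> S n \<longrightarrow> \<omega> \<in> T" using z(1,2) by (auto simp: \<G>_def)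
  qed
  then obtain z where z: "z \<in> carrier N" "q z = z"
    and largest: "\<And>u. \<lbrakk>u \<in> carrier N; q u = u\<rbrakk> \<Longrightarrow> AE \<omega> in M. \<omega> \<in> supp u \<longrightarrow> \<omega> \<in> supp z"
    by (auto simp: \<G>_def)
  define c where "c = L0_indicator M (space M - supp z)"
  have c: "c \<in> carrier (L0 M)" using supp_sets[OF z(1)] by (simp add: c_def)
  have AE_c: "AE \<omega> in M. L0_rep c \<omega> = indicator (space M - supp z) \<omega>"
    unfolding c_def using supp_sets[OF z(1)] by (intro AE_L0_indicator) auto
  have "c \<odot>\<^bsub>N\<^esub> q u = \<zero>\<^bsub>N\<^esub>" if u: "u \<in> carrier N" for u
  proof (rule ip_definite)
    show cqu: "c \<odot>\<^bsub>N\<^esub> q u \<in> carrier N" using c q_range[OF u] by simp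
    show "ip (c \<odot>\<^bsub>N\<^esub> q u) (c \<odot>\<^bsub>N\<^esub> q u) = \<zero>\<^bsub>L0 M\<^esub>"
      using AE_ip_scaled[OF c q_range(2)[OF u]] AE_c largest[OF q_range(2,1)[OF u]] AE_L0_zero AE_space
      by (intro L0_eqI[OF ip_closed[OF cqu cqu] R.zero_closed], eventually_elim)
        (auto simp: supp_def indicator_def)
  qed
  then have "c = \<zero>\<^bsub>L0 M\<^esub>" by (rule q_faithful[OF c])
  then have "AE \<omega> in M. L0_rep c \<omega> = 0" using AE_L0_zero by simp
  then have "AE \<omega> in M. L0_rep (ip z z) \<omega> \<noteq> 0"
    using AE_c AE_space by eventually_elim (auto simp: supp_def)
  with z show thesis by (rule that)
qed

theorem spatial: "spatial_on (lin_ops (L0 M) N) U \<alpha>"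
proof -
  obtain z where z: "z \<in> carrier N" "q z = z" "AE \<omega> in M. L0_rep (ip z z) \<omega> \<noteq> 0"
    by (rule q_range_full_support)
  define v where "v = L0_class M (\<lambda>\<omega>. inverse (L0_rep (ip z z) \<omega>))"
  have meas: "(\<lambda>\<omega>. inverse (L0_rep (ip z z) \<omega>)) \<in> borel_measurable M"
    using L0_rep_measurable[OF ip_closed[OF z(1) z(1)]] by simp
  have v: "v \<in> carrier (L0 M)" unfolding v_def using meas by simp
  have "v \<otimes>\<^bsub>L0 M\<^esub> ip z z = \<one>\<^bsub>L0 M\<^esub>"
    using AE_L0_mult[OF v ip_closed[OF z(1) z(1)]] L0_rep_class(2)[OF meas, folded v_def] AE_L0_one[of M] z(3)
    by (intro L0_eqI[OF R.m_closed[OF v ip_closed[OF z(1) z(1)]] R.one_closed], eventually_elim) simp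
  then show ?thesis
    by (rule spatial_if_q_range_has_unimodular[OF z(1,2) dual_scaled[OF v ip_dual[OF z(1)]]])
qed

end

theorem corollary2:
  fixes M :: "'w measure" and X :: "('w L0, 'x, 'm) module_scheme"
    and ip :: "'x \<Rightarrow> 'x \<Rightarrow> 'w L0" and D :: "'x set" and e :: 'x
  assumes "finite_measure M" and "complete_measure M"
    and "kaplansky_hilbert_module M X ip"
    and "submodule D (L0 M) X" and "bo_dense M X ip D"
    and "e \<in> D" and "L0_norm M ip e = \<one>\<^bsub>L0 M\<^esub>"
  shows "(\<forall>U \<alpha>. standard_algebra (L0 M) (X\<lparr>carrier := D\<rparr>) U \<longrightarrow>
             algebra_automorphism (L0 M) (\<L> M X D) U \<alpha> \<longrightarrow> spatial_on (\<L> M X D) U \<alpha>) \<and>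
         (\<forall>\<alpha>. algebra_automorphism (L0 M) (\<L> M X D) (carrier (\<L> M X D)) \<alpha> \<longrightarrow>
             spatial_on (\<L> M X D) (carrier (\<L> M X D)) \<alpha>)"
proof -
  interpret kaplansky_hilbert_module M X ip by fact
  interpret N: module "L0 M" "X\<lparr>carrier := D\<rparr>"
    by (rule submodule.submodule_is_module[OF assms(4) X.module_axioms])
  have DX: "x \<in> carrier X" if "x \<in> D" for x
    using X.submoduleE(1)[OF assms(4)] that by blast
  have "ip e e = \<one>\<^bsub>L0 M\<^esub>"
  proof (rule L0_eqI)
    \<comment> \<open>a common member of the two classes compares the functions themselves\<close>
    have "L0_class M (\<lambda>\<omega>. csqrt (L0_rep (ip e e) \<omega>)) = L0_class M (\<lambda>_. 1)"
      using assms(7) by (simp add: L0_norm_def L0_map_def L0_def)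
    moreover have "(\<lambda>_. 1) \<in> L0_class M (\<lambda>_. 1)" by (simp add: L0_class_def)
    ultimately have "(\<lambda>_. 1) \<in> L0_class M (\<lambda>\<omega>. csqrt (L0_rep (ip e e) \<omega>))" by (simp only:)
    then have "AE \<omega> in M. 1 = csqrt (L0_rep (ip e e) \<omega>)" by (simp add: L0_class_def)
    with AE_L0_one show "AE \<omega> in M. L0_rep (ip e e) \<omega> = L0_rep \<one>\<^bsub>L0 M\<^esub> \<omega>"
      by eventually_elim (metis power2_csqrt one_power2)
  qed (use DX[OF assms(6)] ip_closed in simp_all)
  then have spatial: "spatial_on (\<L> M X D) U \<alpha>"
    if "standard_algebra (L0 M) (X\<lparr>carrier := D\<rparr>) U" "algebra_automorphism (L0 M) (\<L> M X D) U \<alpha>"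
    for U \<alpha>
  proof -
    interpret standard_automorphism "L0 M" "X\<lparr>carrier := D\<rparr>" e "\<lambda>u. ip u e" U \<alpha>
    proof
      show "(\<lambda>u. ip u e) \<in> N.dual"
        by (rule N.dualI) (simp_all add: DX assms(6) ip_closed ip_add ip_smult)
    qed (use assms(6) \<open>ip e e = \<one>\<^bsub>L0 M\<^esub>\<close> that in simp_all)
    interpret finite_measure M by fact
    interpret L0_standard_automorphism M "X\<lparr>carrier := D\<rparr>" ip e U \<alpha>
    proof
      fix x y assume "x \<in> carrier (X\<lparr>carrier := D\<rparr>)" "y \<in> carrier (X\<lparr>carrier := D\<rparr>)"
      then show "ip x y = L0_map M cnj (ip y x)" using ip_cnj[of x y] DX by simp
    qed (simp_all add: DX ip_closed ip_eq_zero ip_add ip_smult)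
    show ?thesis by (rule spatial)
  qed
  then show ?thesis using N.carrier_standard by blast
qed

end
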